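(* Let $k$ be a field of characteristic zero, $k[X]=k[x_0,\ldots,x_n]$, and let $d$ be the Weitzenböck derivation with kernel $k[X]^d$. If $T$ is a subalgebra of $k[X]^d$ such that $x_0\in T$ and $\tau(T)\subseteq T$, then $T=k[X]^d$.
   Context: The Weitzenböck derivation $d$ of $k[X]$ is the $k$-linear derivation with $d(x_0)=0$, $d(x_i)=x_{i-1}$ for $1\le i\le n$. $\hat d$ is the $k$-linear derivation with $\hat d(x_i)=(i+1)(n-i)x_{i+1}$ for $0\le i<n$, $\hat d(x_n)=0$. The weight of a monomial $x_0^{\alpha_0}\cdots x_n^{\alpha_n}$ is $n\sum_i\alpha_i-2(\alpha_1+2\alpha_2+\cdots+n\alpha_n)$; a nonzero homogeneous polynomial is isobaric if all its monomials have equal weight, and this common value is its weight $\omega(z)$. The order $\mathrm{ord}(z)$ of a nonzero polynomial $z$ is the natural number $s\ge0$ with $\hat d^{\,s}(z)\ne0$, $\hat d^{\,s+1}(z)=0$. For a nonzero homogeneous isobaric $z\in k[X]^d$ and $0\le i\le\min(\mathrm{ord}(z),n)$ put $$\tau_i(z)=\sum_{j=0}^{i}(-1)^{j}x_{i-j}\,v_j(z),\qquad v_j(z)=\frac{(\omega(z)-j)!}{j!\,\omega(z)!}\,\hat d^{\,j}(z)$$ (an element of $k[X]^d$). The map $\tau_i$ is extended by linearity to all sums of homogeneous isobaric elements of $k[X]^d$ of order $\ge i$. For a subalgebra $T\subseteq k[X]^d$, $\tau(T)$ denotes the subalgebra generated by all the elements $\tau_i(z)$, $z\in T$, $0\le i\le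 n$, for which $\tau_i(z)$ is defined. Subalgebras are unital $k$-subalgebras. *)

theory Defs
  imports Complex_Main "HOL-Library.Poly_Mapping"
begin

text \<open>
  Polynomials are finitely supported functions from exponent vectors to coefficients, with the
  convolution product of \<^theory>\<open>HOL-Library.Poly_Mapping\<close>, in countably many variables
  \<open>x\<^sub>0, x\<^sub>1, \<dots>\<close>; the ring \<open>k[x\<^sub>0, \<dots>, x\<^sub>n]\<close> is the subset \<open>polys n\<close>.
\<close>

type_synonym 'k mpoly = "(nat \<Rightarrow>\<^sub>0 nat) \<Rightarrow>\<^sub>0 'k"

abbreviation keys :: "('a \<Rightarrow>\<^sub>0 'b::zero) \<Rightarrow> 'a set"
  where "keys \<equiv> Poly_Mapping.keys"

abbreviation lookup :: "('a \<Rightarrow>\<^sub>0 'b::zero) \<Rightarrow> 'a \<Rightarrow> 'b"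
  where "lookup \<equiv> Poly_Mapping.lookup"

abbreviation mpmonom :: "(nat \<Rightarrow>\<^sub>0 nat) \<Rightarrow> 'k::zero \<Rightarrow> 'k mpoly"
  where "mpmonom \<alpha> c \<equiv> Poly_Mapping.single \<alpha> c"

definition var :: "nat \<Rightarrow> 'k::zero_neq_one mpoly"
  where "var i = mpmonom (Poly_Mapping.single i 1) 1"

definition smult :: "'k::comm_semiring_1 \<Rightarrow> 'k mpoly \<Rightarrow> 'k mpoly"
  where "smult c p = mpmonom 0 c * p"

definition polys :: "nat \<Rightarrow> 'k::zero mpoly set"
  where "polys n = {p. \<forall>\<alpha>\<in>keys p. keys \<alpha> \<subseteq> {..n}}"

subsection \<open>Derivations\<close>

text \<open>The \<open>k\<close>-linear derivation sending each variable \<open>x\<^sub>i\<close> to \<open>g i\<close>, that is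
  \<open>p \<mapsto> \<Sum>\<^sub>i g i * \<partial>p/\<partial>x\<^sub>i\<close>.\<close>

definition derivation_of :: "(nat \<Rightarrow> 'k mpoly) \<Rightarrow> 'k::comm_ring_1 mpoly \<Rightarrow> 'k mpoly"
  where "derivation_of g p =
    (\<Sum>\<alpha>\<in>keys p. \<Sum>i\<in>keys \<alpha>.
       mpmonom (\<alpha> - Poly_Mapping.single i 1) (of_nat (lookup \<alpha> i) * lookup p \<alpha>) * g i)"

definition weitz :: "nat \<Rightarrow> 'k::comm_ring_1 mpoly \<Rightarrow> 'k mpoly"
  where "weitz n = derivation_of (\<lambda>i. if 1 \<le> i \<and> i \<le> n then var (i - 1) else 0)"

definition weitz_hat :: "nat \<Rightarrow> 'k::comm_ring_1 mpoly \<Rightarrow> 'k mpoly"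
  where "weitz_hat n =
    derivation_of (\<lambda>i. if i < n then smult (of_nat ((i + 1) * (n - i))) (var (i + 1)) else 0)"

definition weitz_kernel :: "nat \<Rightarrow> 'k::comm_ring_1 mpoly set"
  where "weitz_kernel n = {p \<in> polys n. weitz n p = 0}"

lemma poly_eq_sum_mono: "(\<Sum>\<alpha>\<in>keys p. mpmonom \<alpha> (lookup p \<alpha>)) = p"
  by (rule poly_mapping_eqI)
    (auto simp: lookup_sum lookup_single when_def in_keys_iff intro: sum.neutral)

lemma derivation_of_alt:
  assumes "finite S" "keys p \<subseteq> S"
  shows "derivation_of g p =
    (\<Sum>\<alpha>\<in>S. \<Sum>i\<in>keys \<alpha>.
       mpmonom (\<alpha> - Poly_Mapping.single i 1) (of_nat (lookup \<alpha> i) * lookup p \<alpha>) * g i)"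
  unfolding derivation_of_def
  by (rule sum.mono_neutral_left) (use assms in \<open>auto simp: in_keys_iff\<close>)

lemma derivation_of_zero [simp]: "derivation_of g 0 = 0"
  by (simp add: derivation_of_def)

lemma derivation_of_add: "derivation_of g (p + q) = derivation_of g p + derivation_of g q"
proof -
  have "keys (p + q) \<subseteq> keys p \<union> keys q" by (rule keys_add)
  then show ?thesis
    using derivation_of_alt[of "keys p \<union> keys q" "p + q" g]
      derivation_of_alt[of "keys p \<union> keys q" p g] derivation_of_alt[of "keys p \<union> keys q" q g]
    by (simp add: lookup_add distrib_left distrib_right single_add sum.distrib)
qed

lemma derivation_of_sum: "derivation_of g (\<Sum>a\<in>A. f a) = (\<Sum>a\<in>A. derivation_of g (f a))"
  by (induction A rule: infinite_finite_induct) (auto simp: derivation_of_add)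

lemma derivation_of_mono:
  assumes "finite I" "keys \<alpha> \<subseteq> I"
  shows "derivation_of g (mpmonom \<alpha> c) =
    (\<Sum>i\<in>I. mpmonom (\<alpha> - Poly_Mapping.single i 1) (of_nat (lookup \<alpha> i) * c) * g i)"
proof -
  have "derivation_of g (mpmonom \<alpha> c) =
    (\<Sum>i\<in>keys \<alpha>. mpmonom (\<alpha> - Poly_Mapping.single i 1) (of_nat (lookup \<alpha> i) * c) * g i)"
    using derivation_of_alt[of "{\<alpha>}" "mpmonom \<alpha> c" g] by simp
  also have "\<dots> = (\<Sum>i\<in>I. mpmonom (\<alpha> - Poly_Mapping.single i 1) (of_nat (lookup \<alpha> i) * c) * g i)"
    by (rule sum.mono_neutral_left) (use assms in \<open>auto simp: in_keys_iff\<close>)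
  finally show ?thesis .
qed

lemma derivation_of_var: "derivation_of g (var i) = g i"
  using derivation_of_mono[of "{i}" "Poly_Mapping.single i 1" g 1]
  by (simp add: var_def)

lemma exponent_diff_add:
  assumes "lookup \<alpha> i \<noteq> (0::nat)"
  shows "\<alpha> - Poly_Mapping.single i 1 + \<beta> = \<alpha> + \<beta> - Poly_Mapping.single i 1"
  by (rule poly_mapping_eqI)
    (use assms in \<open>auto simp: lookup_add lookup_minus lookup_single when_def\<close>)

lemma derivation_of_mono_mult:
  "derivation_of g (mpmonom \<alpha> a * mpmonom \<beta> b) =
     derivation_of g (mpmonom \<alpha> a) * mpmonom \<beta> b + mpmonom \<alpha> a * derivation_of g (mpmonom \<beta> b)"
proof -
  let ?I = "keys \<alpha> \<union> keys \<beta>" and ?e = "\<lambda>i. Poly_Mapping.single i (1::nat)"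
  have 1: "mpmonom (\<alpha> - ?e i) (of_nat (lookup \<alpha> i) * a) * g i * mpmonom \<beta> b =
      mpmonom (\<alpha> + \<beta> - ?e i) (of_nat (lookup \<alpha> i) * (a * b)) * g i" for i
  proof (cases "lookup \<alpha> i = 0")
    case False
    have "mpmonom (\<alpha> - ?e i) (of_nat (lookup \<alpha> i) * a) * g i * mpmonom \<beta> b =
        (mpmonom (\<alpha> - ?e i) (of_nat (lookup \<alpha> i) * a) * mpmonom \<beta> b) * g i" by (simp only: ac_simps)
    then show ?thesis
      unfolding mult_single exponent_diff_add[OF False] by (simp only: mult.assoc)
  qed simp
  have 2: "mpmonom \<alpha> a * (mpmonom (\<beta> - ?e i) (of_nat (lookup \<beta> i) * b) * g i) =
      mpmonom (\<alpha> + \<beta> - ?e i) (of_nat (lookup \<beta> i) * (a * b)) * g i" for i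
  proof (cases "lookup \<beta> i = 0")
    case False
    have "mpmonom \<alpha> a * (mpmonom (\<beta> - ?e i) (of_nat (lookup \<beta> i) * b) * g i) =
        (mpmonom (\<beta> - ?e i) (of_nat (lookup \<beta> i) * b) * mpmonom \<alpha> a) * g i" by (simp only: ac_simps)
    then show ?thesis
      unfolding mult_single exponent_diff_add[OF False] by (simp only: ac_simps)
  qed simp
  have "keys (\<alpha> + \<beta>) \<subseteq> ?I" by (rule keys_add)
  then have "derivation_of g (mpmonom \<alpha> a * mpmonom \<beta> b) =
      (\<Sum>i\<in>?I. mpmonom (\<alpha> + \<beta> - ?e i) (of_nat (lookup (\<alpha> + \<beta>) i) * (a * b)) * g i)"
    unfolding mult_single by (intro derivation_of_mono) auto
  also have "\<dots> = (\<Sum>i\<in>?I. mpmonom (\<alpha> - ?e i) (of_nat (lookup \<alpha> i) * a) * g i * mpmonom \<beta> b)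
      + (\<Sum>i\<in>?I. mpmonom \<alpha> a * (mpmonom (\<beta> - ?e i) (of_nat (lookup \<beta> i) * b) * g i))"
    unfolding 1 2 by (simp add: lookup_add distrib_right single_add sum.distrib)
  also have "\<dots> = derivation_of g (mpmonom \<alpha> a) * mpmonom \<beta> b + mpmonom \<alpha> a * derivation_of g (mpmonom \<beta> b)"
    by (simp add: derivation_of_mono[of ?I] sum_distrib_left sum_distrib_right)
  finally show ?thesis .
qed

lemma derivation_of_mult:
  "derivation_of g (p * q) = derivation_of g p * q + p * derivation_of g q"
proof -
  let ?m = "\<lambda>p \<alpha>. mpmonom \<alpha> (lookup p \<alpha>)"
  have "derivation_of g ((\<Sum>\<alpha>\<in>keys p. ?m p \<alpha>) * (\<Sum>\<beta>\<in>keys q. ?m q \<beta>)) =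
      derivation_of g (\<Sum>\<alpha>\<in>keys p. ?m p \<alpha>) * (\<Sum>\<beta>\<in>keys q. ?m q \<beta>) +
      (\<Sum>\<alpha>\<in>keys p. ?m p \<alpha>) * derivation_of g (\<Sum>\<beta>\<in>keys q. ?m q \<beta>)"
    by (simp only: sum_product derivation_of_sum derivation_of_mono_mult sum.distrib)
  then show ?thesis by (simp only: poly_eq_sum_mono)
qed

lemma derivation_of_const: "derivation_of g (mpmonom 0 c) = 0"
  using derivation_of_mono[of "{}" 0 g c] by simp

lemma derivation_of_smult: "derivation_of g (smult c p) = smult c (derivation_of g p)"
  by (simp add: smult_def derivation_of_mult derivation_of_const)

lemma weitz_var: "weitz n (var i) = (if 1 \<le> i \<and> i \<le> n then var (i - 1) else 0)"
  by (simp only: weitz_def derivation_of_var)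

lemma weitz_hat_var:
  "weitz_hat n (var i) = (if i < n then smult (of_nat ((i + 1) * (n - i))) (var (i + 1)) else 0)"
  by (simp only: weitz_hat_def derivation_of_var)

subsection \<open>Homogeneous isobaric polynomials, weight and order\<close>

definition mono_degree :: "(nat \<Rightarrow>\<^sub>0 nat) \<Rightarrow> nat"
  where "mono_degree \<alpha> = (\<Sum>i\<in>keys \<alpha>. lookup \<alpha> i)"

definition mono_weight :: "nat \<Rightarrow> (nat \<Rightarrow>\<^sub>0 nat) \<Rightarrow> int"
  where "mono_weight n \<alpha> =
    int n * (\<Sum>i\<in>keys \<alpha>. int (lookup \<alpha> i)) - 2 * (\<Sum>i\<in>keys \<alpha>. int i * int (lookup \<alpha> i))"

definition homogeneous :: "'k::zero mpoly \<Rightarrow> bool"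
  where "homogeneous p \<longleftrightarrow> (\<exists>m. \<forall>\<alpha>\<in>keys p. mono_degree \<alpha> = m)"

definition isobaric :: "nat \<Rightarrow> 'k::zero mpoly \<Rightarrow> bool"
  where "isobaric n p \<longleftrightarrow> (\<exists>w. \<forall>\<alpha>\<in>keys p. mono_weight n \<alpha> = w)"

text \<open>The following two notions are meaningful only for \<open>p \<noteq> 0\<close>.\<close>

definition weight :: "nat \<Rightarrow> 'k::zero mpoly \<Rightarrow> int"
  where "weight n p = (THE w. \<forall>\<alpha>\<in>keys p. mono_weight n \<alpha> = w)"

definition hat_ord :: "nat \<Rightarrow> 'k::comm_ring_1 mpoly \<Rightarrow> nat"
  where "hat_ord n p = (THE s. (weitz_hat n ^^ s) p \<noteq> 0 \<and> (weitz_hat n ^^ Suc s) p = 0)"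

subsection \<open>The maps \<open>\<tau>\<^sub>i\<close>\<close>

text \<open>A nonzero homogeneous isobaric element \<open>z\<close> of the kernel has \<open>weight n z = hat_ord n z\<close>,
  so for \<open>j \<le> hat_ord n z\<close> the conversions to \<^typ>\<open>nat\<close> below do not truncate.\<close>

definition tau_v :: "nat \<Rightarrow> nat \<Rightarrow> 'k::field_char_0 mpoly \<Rightarrow> 'k mpoly"
  where "tau_v n j z =
    smult (fact (nat (weight n z - int j)) / (fact j * fact (nat (weight n z))))
      ((weitz_hat n ^^ j) z)"

definition tau :: "nat \<Rightarrow> nat \<Rightarrow> 'k::field_char_0 mpoly \<Rightarrow> 'k mpoly"
  where "tau n i z = (\<Sum>j=0..i. (-1) ^ j * var (i - j) * tau_v n j z)"

definition tau_base :: "nat \<Rightarrow> nat \<Rightarrow> 'k::field_char_0 mpoly set"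
  where "tau_base n i =
    {z \<in> weitz_kernel n. z \<noteq> 0 \<and> homogeneous z \<and> isobaric n z \<and> i \<le> min (hat_ord n z) n}"

text \<open>The linear extension of \<open>\<tau>\<^sub>i\<close>, as a graph: \<open>tau_ext n i z y\<close> says that \<open>\<tau>\<^sub>i(z)\<close> is defined
  and equals \<open>y\<close>. Since \<open>tau_base n i\<close> is closed under nonzero scalars, plain sums
  suffice. Single-valuedness is \<open>tau_ext_unique\<close>.\<close>

definition tau_ext :: "nat \<Rightarrow> nat \<Rightarrow> 'k::field_char_0 mpoly \<Rightarrow> 'k mpoly \<Rightarrow> bool"
  where "tau_ext n i z y \<longleftrightarrow>
    (\<exists>zs. set zs \<subseteq> tau_base n i \<and> z = sum_list zs \<and> y = sum_list (map (tau n i) zs))"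

lemma tau_ext_base: "z \<in> tau_base n i \<Longrightarrow> tau_ext n i z (tau n i z)"
  unfolding tau_ext_def by (rule exI[of _ "[z]"]) simp

lemma weight_eq:
  assumes "isobaric n p" "\<alpha> \<in> keys p"
  shows "weight n p = mono_weight n \<alpha>"
  unfolding weight_def using assms by (intro the_equality) (auto simp: isobaric_def)

lemma weitz_hat_funpow_sum:
  "(weitz_hat n ^^ j) (\<Sum>a\<in>A. f a) = (\<Sum>a\<in>A. (weitz_hat n ^^ j) (f a))"
  by (induction j) (simp_all add: weitz_hat_def derivation_of_sum)

lemma weitz_hat_funpow_add:
  "(weitz_hat n ^^ j) (p + q) = (weitz_hat n ^^ j) p + (weitz_hat n ^^ j) q"
  by (induction j) (simp_all add: weitz_hat_def derivation_of_add)

lemma weitz_hat_funpow_zero: "(weitz_hat n ^^ j) 0 = 0"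
  using weitz_hat_funpow_sum[where A = "{}"] by simp

lemma tau_ext_unique:
  fixes z :: "'k::field_char_0 mpoly"
  assumes "tau_ext n i z y" "tau_ext n i z y'"
  shows "y = y'"
proof -
  define c :: "nat \<Rightarrow> (nat \<Rightarrow>\<^sub>0 nat) \<Rightarrow> 'k" where
    "c j \<alpha> = fact (nat (mono_weight n \<alpha> - int j)) / (fact j * fact (nat (mono_weight n \<alpha>)))"
    for j \<alpha>
  define M :: "(nat \<Rightarrow>\<^sub>0 nat) \<Rightarrow> 'k \<Rightarrow> 'k mpoly" where
    "M \<alpha> a = (\<Sum>j=0..i. (-1) ^ j * var (i - j) * smult (c j \<alpha>) ((weitz_hat n ^^ j) (mpmonom \<alpha> a)))"
    for \<alpha> a
  define L :: "'k mpoly \<Rightarrow> 'k mpoly" where "L p = (\<Sum>\<alpha>\<in>keys p. M \<alpha> (lookup p \<alpha>))" for p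
  have M0: "M \<alpha> 0 = 0" for \<alpha>
    by (simp add: M_def weitz_hat_funpow_zero smult_def)
  have M_add: "M \<alpha> (a + b) = M \<alpha> a + M \<alpha> b" for \<alpha> a b
    by (simp add: M_def single_add weitz_hat_funpow_add smult_def distrib_left sum.distrib)
  have L_alt: "L p = (\<Sum>\<alpha>\<in>S. M \<alpha> (lookup p \<alpha>))" if "finite S" "keys p \<subseteq> S" for p S
    unfolding L_def by (rule sum.mono_neutral_left) (use that M0 in \<open>auto simp: in_keys_iff\<close>)
  have L_add: "L (p + q) = L p + L q" for p q
    using L_alt[of "keys p \<union> keys q" "p + q"] L_alt[of "keys p \<union> keys q" p]
      L_alt[of "keys p \<union> keys q" q] keys_add[of p q]
    by (simp add: lookup_add M_add sum.distrib)
  have L_tau: "L p = tau n i p" if "p \<in> tau_base n i" for p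
  proof -
    define w where "w j = (fact (nat (weight n p - int j)) / (fact j * fact (nat (weight n p))) :: 'k)"
      for j
    have cw: "c j \<alpha> = w j" if "\<alpha> \<in> keys p" for j \<alpha>
      using weight_eq[of n p \<alpha>] that \<open>p \<in> tau_base n i\<close> by (simp add: c_def w_def tau_base_def)
    have "L p = (\<Sum>\<alpha>\<in>keys p. \<Sum>j=0..i. (-1) ^ j * var (i - j) *
        smult (w j) ((weitz_hat n ^^ j) (mpmonom \<alpha> (lookup p \<alpha>))))"
      unfolding L_def M_def by (intro sum.cong refl) (simp add: cw)
    also have "\<dots> = (\<Sum>j=0..i. (-1) ^ j * var (i - j) *
        smult (w j) ((weitz_hat n ^^ j) (\<Sum>\<alpha>\<in>keys p. mpmonom \<alpha> (lookup p \<alpha>))))"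
      by (subst sum.swap) (simp add: weitz_hat_funpow_sum smult_def sum_distrib_left)
    also have "\<dots> = tau n i p"
      by (simp add: poly_eq_sum_mono tau_def tau_v_def w_def)
    finally show ?thesis .
  qed
  have L_list: "sum_list (map (tau n i) zs) = L (sum_list zs)" if "set zs \<subseteq> tau_base n i" for zs
    using that by (induction zs) (simp_all add: L_add L_tau, simp add: L_def)
  show ?thesis using assms L_list unfolding tau_ext_def by metis
qed

subsection \<open>Subalgebras\<close>

definition subalgebra :: "'k::comm_ring_1 mpoly set \<Rightarrow> bool"
  where "subalgebra A \<longleftrightarrow>
    1 \<in> A \<and> (\<forall>p\<in>A. \<forall>q\<in>A. p + q \<in> A) \<and> (\<forall>p\<in>A. \<forall>q\<in>A. p * q \<in> A) \<and> (\<forall>c. \<forall>p\<in>A. smult c p \<in> A)"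

definition tau_closure :: "nat \<Rightarrow> 'k::field_char_0 mpoly set \<Rightarrow> 'k mpoly set"
  where "tau_closure n T = subalgebra hull {y. \<exists>z\<in>T. \<exists>i\<le>n. tau_ext n i z y}"

end

theory Submission
  imports Defs
begin

text \<open>
  The idea is that \<open>x\<^sub>0, \<dots>, x\<^sub>n\<close> span an irreducible representation \<open>V\<close> of \<open>sl\<^sub>2\<close>, on which \<open>d\<close>
  (\<open>weitz n\<close>) and \<open>weitz_hat n\<close> act as the raising and the lowering operator, and that \<open>k[X]\<close> is its
  symmetric algebra, so that \<open>ker d\<close> is spanned by the highest weight vectors. Write \<open>k[X]\<^sub>m\<close> for the forms of degree \<open>m\<close>. If
  \<open>z \<in> k[X]\<^sub>m\<close> is a highest weight vector of weight \<open>s\<close>, the highest weight vectors that come from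
  \<open>z\<close> in \<open>V \<otimes> k[X]\<^sub>m\<close> are, by Clebsch--Gordan, the \<open>\<Sum>\<^sub>j (-1)\<^sup>j x\<^bsub>i-j\<^esub> \<otimes> v\<^sub>j(z)\<close> with
  \<open>i \<le> min(s, n)\<close>, and multiplication takes them to the \<open>\<tau>\<^sub>i(z)\<close>. Multiplication is an equivariant
  map onto \<open>k[X]\<^bsub>m+1\<^esub>\<close>, and by Euler's identity it is split by
  \<open>p \<mapsto> 1/(m+1) \<Sum>\<^sub>i x\<^sub>i \<otimes> \<partial>p/\<partial>x\<^sub>i\<close>. So every highest weight vector of degree \<open>m+1\<close> is a combination of
  elements \<open>\<tau>\<^sub>i(z)\<close> with \<open>z\<close> of degree \<open>m\<close>, and induction on the degree gives the theorem.

  The argument below makes this explicit without tensor products or complete reducibility. A highest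
  weight vector \<open>\<Sum>\<^sub>i x\<^sub>i \<otimes> c\<^sub>i\<close> is a chain of polynomials with \<open>d(c\<^sub>i) = -c\<^bsub>i+1\<^esub>\<close>; the partial
  derivatives of an element of \<open>ker d\<close> form such a chain (\<open>weitz_partial\<close>). The last nonzero term
  \<open>z = c\<^sub>r\<close> of a chain lies in \<open>ker d\<close>, and because \<open>d(v\<^bsub>j+1\<^esub>(z)) = v\<^sub>j(z)\<close>, the coefficients of
  \<open>\<tau>\<^sub>r(z)\<close> form another chain with the same last term. Subtracting it shortens the chain
  (\<open>sum_chain_mem\<close>). The delicate point is that \<open>\<tau>\<^sub>r(z)\<close> is defined, that is, \<open>r \<le> ord(z)\<close>. This
  holds since \<open>z = \<plusminus>d\<^sup>r(c\<^sub>0)\<close>: a highest weight vector of weight \<open>s\<close> in the image of the \<open>r\<close>-th power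
  of the raising operator satisfies \<open>r \<le> s\<close> (\<open>le_weight_if_e_pow_highest\<close>), as one sees from the
  injectivity of \<open>e\<^sup>a\<close> on the vectors of weight \<open>-a\<close> (\<open>f_pow_weight_eq_0D\<close>, with \<open>e\<close> and \<open>f\<close>
  exchanged).
\<close>

section \<open>Weight vectors under an action of sl2\<close>

text \<open>
  \<open>W w\<close> need not be the whole weight space: only its stability under the shifts by \<open>e\<close> and \<open>f\<close> and the
  commutator on it matter. Neither finite dimension nor nilpotency is built in; the lemmas ask for
  nilpotency at individual vectors, as polynomials of all degrees form an infinite-dimensional space.
\<close>

locale sl2_action = vector_space scale
  for scale :: "'a::field_char_0 \<Rightarrow> 'b::ab_group_add \<Rightarrow> 'b" +
  fixes e f :: "'b \<Rightarrow> 'b" and W :: "int \<Rightarrow> 'b set"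
  assumes e_add: "e (u + v) = e u + e v" and e_scale: "e (scale c u) = scale c (e u)"
    and f_add: "f (u + v) = f u + f v" and f_scale: "f (scale c u) = scale c (f u)"
    and e_W: "v \<in> W w \<Longrightarrow> e v \<in> W (w + 2)" and f_W: "v \<in> W w \<Longrightarrow> f v \<in> W (w - 2)"
    and commutator: "v \<in> W w \<Longrightarrow> e (f v) = f (e v) + scale (of_int w) v"
begin

lemma e_zero: "e 0 = 0"
  using e_scale[of 0 0] by simp

lemma f_zero: "f 0 = 0"
  using f_scale[of 0 0] by simp

lemma f_pow_W: "v \<in> W w \<Longrightarrow> (f ^^ k) v \<in> W (w - 2 * int k)"
proof (induction k)
  case (Suc k)
  then show ?case using f_W[of "(f ^^ k) v" "w - 2 * int k"] by (simp add: algebra_simps)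
qed simp

lemma f_pow_zero: "(f ^^ k) 0 = 0"
  by (induction k) (simp_all add: f_zero)

lemma e_pow_zero: "(e ^^ k) 0 = 0"
  by (induction k) (simp_all add: e_zero)

lemma e_f_pow:
  assumes "v \<in> W w"
  shows "e ((f ^^ Suc k) v) =
    (f ^^ Suc k) (e v) + scale (of_int ((int k + 1) * (w - int k))) ((f ^^ k) v)"
proof (induction k)
  case 0
  show ?case using commutator[OF assms] by simp
next
  case (Suc k)
  let ?u = "(f ^^ Suc k) v"
  have "e (f ?u) = f (e ?u) + scale (of_int (w - 2 * int (Suc k))) ?u"
    by (rule commutator[OF f_pow_W[OF assms]])
  also have "f (e ?u) = (f ^^ Suc (Suc k)) (e v) +
      scale (of_int ((int k + 1) * (w - int k))) ?u"
    unfolding Suc.IH by (simp add: f_add f_scale)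
  finally have "e (f ?u) = (f ^^ Suc (Suc k)) (e v) +
      scale (of_int ((int k + 1) * (w - int k)) + of_int (w - 2 * int (Suc k))) ?u"
    by (simp only: scale_left_distrib add.assoc)
  moreover have "(int k + 1) * (w - int k) + (w - 2 * int (Suc k)) =
      (int (Suc k) + 1) * (w - int (Suc k))"
    by (simp add: algebra_simps)
  ultimately show ?case by (simp only: of_int_add [symmetric] funpow.simps o_apply)
qed

text \<open>
  Applying \<open>e\<close> to \<open>f\<^bsup>k+1\<^esup> y = 0\<close> leaves \<open>(k+1)(a-k) f\<^sup>k y = 0\<close>, and the factor is nonzero for \<open>k < a\<close>.
\<close>

lemma f_pow_highest_eq_0D:
  assumes "y \<in> W (int a)" "e y = 0" "(f ^^ k) y = 0" "k \<le> a"
  shows "y = 0"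
  using assms(3,4)
proof (induction k)
  case (Suc k)
  have "scale (of_int ((int k + 1) * (int a - int k))) ((f ^^ k) y) = 0"
    using e_f_pow[OF assms(1), of k] Suc.prems(1) assms(2) by (simp only: e_zero f_pow_zero) simp
  moreover have "(int k + 1) * (int a - int k) \<noteq> 0" using Suc.prems(2) by simp
  ultimately have "(f ^^ k) y = 0" by (simp only: scale_eq_0_iff of_int_eq_0_iff) simp
  then show ?case using Suc by simp
qed simp

text \<open>
  Half of the symmetry between the weights \<open>a\<close> and \<open>-a\<close>, obtained without complete reducibility: if
  \<open>f\<^sup>a y = 0\<close>, then \<open>f\<^bsup>a+2\<^esup>\<close> kills \<open>e y\<close>, which has weight \<open>a+2\<close> and a smaller nilpotency index for
  \<open>e\<close>. So the claim descends to vectors killed by \<open>e\<close>.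
\<close>

lemma f_pow_weight_eq_0D:
  assumes "y \<in> W (int a)" "(e ^^ N) y = 0" "(f ^^ a) y = 0"
  shows "y = 0"
  using assms
proof (induction N arbitrary: y a)
  case (Suc N)
  have ey: "e y \<in> W (int (a + 2))" using e_W[OF Suc.prems(1)] by (simp add: add.commute)
  have "f ((f ^^ a) y) = 0" using Suc.prems(3) by (simp add: f_zero)
  then have *: "(f ^^ Suc a) y = 0" "(f ^^ Suc (Suc a)) y = 0" by (simp_all add: f_zero)
  have "(f ^^ Suc (Suc a)) (e y) = 0"
    using e_f_pow[OF Suc.prems(1), of "Suc a"] unfolding * by (simp add: e_zero)
  then have "e y = 0"
    using Suc.IH[OF ey] Suc.prems(2) by (simp add: funpow_swap1)
  then show ?case using f_pow_highest_eq_0D[OF Suc.prems(1) _ Suc.prems(3)] by simp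
qed simp

text \<open>Exchanging \<open>e\<close> and \<open>f\<close> and negating weights transfers the previous lemma to powers of \<open>e\<close>.\<close>

lemma swap: "sl2_action scale f e (\<lambda>w. W (- w))"
proof
  show "f (e v) = e (f v) + scale (of_int w) v" if "v \<in> W (- w)" for v w
    using commutator[OF that] by simp
  show "f v \<in> W (- (w + 2))" if "v \<in> W (- w)" for v w
    using f_W[OF that] by simp
  show "e v \<in> W (- (w - 2))" if "v \<in> W (- w)" for v w
    using e_W[OF that] by (simp add: algebra_simps)
qed (rule e_add e_scale f_add f_scale)+

text \<open>
  If \<open>r > s\<close>, then \<open>a = 2r - s\<close> exceeds \<open>r\<close>, so \<open>e\<^sup>a u = 0\<close> although \<open>u\<close> has weight \<open>-a\<close>; injectivity
  of \<open>e\<^sup>a\<close> there forces \<open>u = 0\<close>. For \<open>r = 0\<close> this says that highest weights are nonnegative.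
\<close>

lemma le_weight_if_e_pow_highest:
  assumes "u \<in> W (s - 2 * int r)" "(f ^^ N) u = 0" "e ((e ^^ r) u) = 0" "(e ^^ r) u \<noteq> 0"
  shows "int r \<le> s"
proof (rule ccontr)
  assume "\<not> int r \<le> s"
  define a where "a = nat (2 * int r - s)"
  have a: "int a = 2 * int r - s" "Suc r \<le> a" using \<open>\<not> int r \<le> s\<close> by (auto simp: a_def)
  interpret swapped: sl2_action scale f e "\<lambda>w. W (- w)" by (rule swap)
  have "(e ^^ a) u = (e ^^ (a - Suc r)) ((e ^^ Suc r) u)"
    using a(2) by (simp only: funpow_add[symmetric, THEN fun_cong, unfolded o_apply]) simp
  then have "(e ^^ a) u = 0" using assms(3) by (simp add: e_pow_zero)
  then have "u = 0"
    using swapped.f_pow_weight_eq_0D[of u a N] assms(1,2) a(1) by simp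
  then show False using assms(4) e_pow_zero by simp
qed

text \<open>
  The vector \<open>f\<^bsup>s+1\<^esup> z\<close> is killed by \<open>e\<close> and has the negative weight \<open>-s-2\<close>, so it vanishes.
\<close>

lemma highest_weight_string:
  assumes "z \<in> W s" "z \<noteq> 0" "e z = 0" "(f ^^ N) z = 0"
  shows "0 \<le> s" "(f ^^ nat s) z \<noteq> 0" "(f ^^ Suc (nat s)) z = 0"
proof -
  show s: "0 \<le> s" using le_weight_if_e_pow_highest[of z s 0 N] assms by simp
  then show "(f ^^ nat s) z \<noteq> 0"
    using f_pow_highest_eq_0D[of z "nat s" "nat s"] assms by auto
  define y where "y = (f ^^ Suc (nat s)) z"
  have "e y = 0"
    unfolding y_def e_f_pow[OF assms(1)] using s assms(3) by (simp add: f_pow_zero f_zero)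
  moreover have "y \<in> W (s - 2 * int (Suc (nat s)))"
    unfolding y_def by (rule f_pow_W[OF assms(1)])
  moreover have "(f ^^ N) y = (f ^^ Suc (nat s)) ((f ^^ N) z)"
    unfolding y_def by (simp only: funpow_add[symmetric, THEN fun_cong, unfolded o_apply] add.commute)
  then have "(f ^^ N) y = 0" by (simp only: assms(4) f_pow_zero)
  ultimately show "y = 0"
    using le_weight_if_e_pow_highest[of y "s - 2 * int (Suc (nat s))" 0 N] s by force
qed

end

section \<open>Polynomials graded by degree and weight\<close>

lemma lookup_smult: "lookup (smult c p) \<alpha> = c * lookup p \<alpha>"
  for c :: "'k::comm_ring_1"
  unfolding smult_def mult_map_scale_conv_mult[symmetric]
  by (simp add: Poly_Mapping.map.rep_eq when_def)

interpretation smult: vector_space "smult :: 'k::field_char_0 \<Rightarrow> 'k mpoly \<Rightarrow> 'k mpoly"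
  by standard (simp_all add: smult_def distrib_left distrib_right single_add mult_single
      mult.assoc[symmetric])

lemma mono_degree_superset:
  "finite S \<Longrightarrow> keys \<alpha> \<subseteq> S \<Longrightarrow> mono_degree \<alpha> = (\<Sum>i\<in>S. lookup \<alpha> i)"
  unfolding mono_degree_def by (rule sum.mono_neutral_left) (auto simp: in_keys_iff)

lemma mono_degree_add: "mono_degree (\<alpha> + \<beta>) = mono_degree \<alpha> + mono_degree \<beta>"
  using mono_degree_superset[of "keys \<alpha> \<union> keys \<beta>"] keys_add[of \<alpha> \<beta>]
  by (simp add: lookup_add sum.distrib)

lemma mono_weight_superset:
  assumes "finite S" "keys \<alpha> \<subseteq> S"
  shows "mono_weight n \<alpha> = (\<Sum>i\<in>S. (int n - 2 * int i) * int (lookup \<alpha> i))"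
proof -
  have "mono_weight n \<alpha> = (\<Sum>i\<in>keys \<alpha>. (int n - 2 * int i) * int (lookup \<alpha> i))"
    by (simp add: mono_weight_def sum_distrib_left sum_subtractf[symmetric] algebra_simps)
  also have "\<dots> = (\<Sum>i\<in>S. (int n - 2 * int i) * int (lookup \<alpha> i))"
    by (rule sum.mono_neutral_left) (use assms in \<open>auto simp: in_keys_iff\<close>)
  finally show ?thesis .
qed

lemma mono_weight_add: "mono_weight n (\<alpha> + \<beta>) = mono_weight n \<alpha> + mono_weight n \<beta>"
  using mono_weight_superset[of "keys \<alpha> \<union> keys \<beta>" _ n] keys_add[of \<alpha> \<beta>]
  by (simp add: lookup_add sum.distrib distrib_left)

lemma mono_degree_single: "mono_degree (Poly_Mapping.single i 1) = 1"
  by (simp add: mono_degree_def)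

lemma mono_weight_single: "mono_weight n (Poly_Mapping.single i 1) = int n - 2 * int i"
  by (simp add: mono_weight_def)

lemma mono_weight_ge:
  assumes "keys \<alpha> \<subseteq> {..n}"
  shows "- (int n * int (mono_degree \<alpha>)) \<le> mono_weight n \<alpha>"
proof -
  have "- (int n * int (mono_degree \<alpha>)) = (\<Sum>i\<in>keys \<alpha>. - int n * int (lookup \<alpha> i))"
    by (simp add: mono_degree_def sum_distrib_left sum_negf)
  also have "\<dots> \<le> (\<Sum>i\<in>keys \<alpha>. (int n - 2 * int i) * int (lookup \<alpha> i))"
    using assms by (intro sum_mono mult_right_mono) auto
  also have "\<dots> = mono_weight n \<alpha>" by (rule mono_weight_superset[symmetric]) auto
  finally show ?thesis .
qed

definition bihom :: "nat \<Rightarrow> nat \<Rightarrow> int \<Rightarrow> 'k::zero mpoly set"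
  where "bihom n m w = {p \<in> polys n. \<forall>\<alpha>\<in>keys p. mono_degree \<alpha> = m \<and> mono_weight n \<alpha> = w}"

lemma bihom_zero: "0 \<in> bihom n m w"
  by (simp add: bihom_def polys_def)

lemma bihom_add: "p \<in> bihom n m w \<Longrightarrow> q \<in> bihom n m w \<Longrightarrow> p + q \<in> bihom n m w"
  using keys_add[of p q] unfolding bihom_def polys_def by blast

lemma bihom_sum: "(\<And>i. i \<in> I \<Longrightarrow> p i \<in> bihom n m w) \<Longrightarrow> sum p I \<in> bihom n m w"
  by (induction I rule: infinite_finite_induct) (auto simp: bihom_zero bihom_add)

lemma bihom_mult:
  assumes "p \<in> bihom n m w" "q \<in> bihom n m' w'"
  shows "p * q \<in> bihom n (m + m') (w + w')"
proof -
  have "keys \<gamma> \<subseteq> {..n} \<and> mono_degree \<gamma> = m + m' \<and> mono_weight n \<gamma> = w + w'"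
    if \<gamma>: "\<gamma> \<in> keys (p * q)" for \<gamma>
  proof -
    obtain \<alpha> \<beta> where *: "\<gamma> = \<alpha> + \<beta>" "\<alpha> \<in> keys p" "\<beta> \<in> keys q"
      using \<gamma> keys_mult[of p q] by blast
    then show ?thesis
      using assms keys_add[of \<alpha> \<beta>]
      by (fastforce simp: bihom_def polys_def mono_degree_add mono_weight_add)
  qed
  then show ?thesis by (auto simp: bihom_def polys_def)
qed

lemma bihom_mpmonom:
  "keys \<alpha> \<subseteq> {..n} \<Longrightarrow> mpmonom \<alpha> c \<in> bihom n (mono_degree \<alpha>) (mono_weight n \<alpha>)"
  by (simp add: bihom_def polys_def)

lemma bihom_const: "mpmonom 0 c \<in> bihom n 0 0"
  using bihom_mpmonom[of 0 n c] by (simp add: mono_degree_def mono_weight_def)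

lemma bihom_var: "i \<le> n \<Longrightarrow> var i \<in> bihom n 1 (int n - 2 * int i)"
  using bihom_mpmonom[of "Poly_Mapping.single i 1" n 1]
  unfolding var_def mono_degree_single mono_weight_single by simp

lemma bihom_smult: "p \<in> bihom n m w \<Longrightarrow> smult c p \<in> bihom n m w"
  unfolding smult_def using bihom_mult[OF bihom_const] by fastforce

lemma bihom_uminus: "p \<in> bihom n m w \<Longrightarrow> - p \<in> bihom n m w"
  for p :: "'k::comm_ring_1 mpoly"
  by (simp add: bihom_def polys_def)

lemma bihom_diff: "p \<in> bihom n m w \<Longrightarrow> q \<in> bihom n m w \<Longrightarrow> p - q \<in> bihom n m w"
  for p :: "'k::comm_ring_1 mpoly"
  using bihom_add[OF _ bihom_uminus, of p n m w q] by simp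

lemma bihom_neg_power: "p \<in> bihom n m w \<Longrightarrow> (-1) ^ j * p \<in> bihom n m w"
  for p :: "'k::comm_ring_1 mpoly"
  by (cases "even j") (simp_all add: bihom_uminus)

lemma derivation_of_bihom:
  assumes p: "p \<in> bihom n m w"
    and g: "\<And>i. i \<le> n \<Longrightarrow> g i \<in> bihom n a (b + (int n - 2 * int i))"
  shows "derivation_of g p \<in> bihom n (m + a - 1) (w + b)"
  unfolding derivation_of_def
proof (intro bihom_sum)
  fix \<alpha> i assume \<alpha>: "\<alpha> \<in> keys p" and i: "i \<in> keys \<alpha>"
  let ?e = "Poly_Mapping.single i (1::nat)"
  have \<alpha>n: "keys \<alpha> \<subseteq> {..n}" "mono_degree \<alpha> = m" "mono_weight n \<alpha> = w"
    using p \<alpha> by (auto simp: bihom_def polys_def)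
  have "lookup \<alpha> i \<noteq> 0" using i by (simp add: in_keys_iff)
  then have eq: "\<alpha> - ?e + ?e = \<alpha>"
    using exponent_diff_add[of \<alpha> i ?e] by simp
  have m: "m = mono_degree (\<alpha> - ?e) + 1"
    using mono_degree_add[of "\<alpha> - ?e" ?e] unfolding eq mono_degree_single \<alpha>n .
  have w: "w = mono_weight n (\<alpha> - ?e) + (int n - 2 * int i)"
    using mono_weight_add[of n "\<alpha> - ?e" ?e] unfolding eq mono_weight_single \<alpha>n .
  have "keys (\<alpha> - ?e) \<subseteq> keys \<alpha>"
    by (auto simp: in_keys_iff lookup_minus)
  then have "keys (\<alpha> - ?e) \<subseteq> {..n}" using \<alpha>n(1) by blast
  from bihom_mult[OF bihom_mpmonom[OF this] g]
  show "mpmonom (\<alpha> - ?e) (of_nat (lookup \<alpha> i) * lookup p \<alpha>) * g i \<in> bihom n (m + a - 1) (w + b)"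
    using i \<alpha>n(1) unfolding m w by (auto simp: algebra_simps)
qed

section \<open>Commutators of derivations\<close>

lemma derivation_of_uminus: "derivation_of g (- p) = - derivation_of g p"
  using derivation_of_add[of g p "- p"] by (simp add: eq_neg_iff_add_eq_0 add.commute)

lemma derivation_of_diff: "derivation_of g (p - q) = derivation_of g p - derivation_of g q"
  using derivation_of_add[of g p "- q"] by (simp add: derivation_of_uminus)

lemma derivation_of_neg_power: "derivation_of g ((-1) ^ j * p) = (-1) ^ j * derivation_of g p"
  by (cases "even j") (simp_all add: derivation_of_uminus)

lemma derivation_of_cong:
  assumes "p \<in> polys n" "\<And>i. i \<le> n \<Longrightarrow> g i = h i"
  shows "derivation_of g p = derivation_of h p"
  unfolding derivation_of_def
  by (intro sum.cong refl) (use assms in \<open>auto simp: polys_def subset_iff\<close>)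

lemma derivation_of_combination:
  "derivation_of (\<lambda>j. \<Sum>i\<in>I. q i * g i j) p = (\<Sum>i\<in>I. q i * derivation_of (g i) p)"
proof -
  have "derivation_of (\<lambda>j. \<Sum>i\<in>I. q i * g i j) p =
    (\<Sum>\<alpha>\<in>keys p. \<Sum>j\<in>keys \<alpha>. \<Sum>i\<in>I.
       q i * (mpmonom (\<alpha> - Poly_Mapping.single j 1) (of_nat (lookup \<alpha> j) * lookup p \<alpha>) * g i j))"
    unfolding derivation_of_def sum_distrib_left by (simp only: ac_simps)
  also have "\<dots> = (\<Sum>\<alpha>\<in>keys p. \<Sum>i\<in>I. \<Sum>j\<in>keys \<alpha>.
       q i * (mpmonom (\<alpha> - Poly_Mapping.single j 1) (of_nat (lookup \<alpha> j) * lookup p \<alpha>) * g i j))"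
    by (intro sum.cong refl sum.swap)
  also have "\<dots> = (\<Sum>i\<in>I. q i * derivation_of (g i) p)"
    unfolding derivation_of_def sum_distrib_left by (rule sum.swap)
  finally show ?thesis .
qed

lemma mpmonom_power_var: "mpmonom (Poly_Mapping.single i b) (1::'k::comm_ring_1) = var i ^ b"
proof (induction b)
  case (Suc b)
  have "mpmonom (Poly_Mapping.single i (Suc b)) (1::'k) =
      mpmonom (Poly_Mapping.single i 1) 1 * mpmonom (Poly_Mapping.single i b) 1"
    by (simp add: mult_single single_add[symmetric])
  then show ?case using Suc by (simp add: var_def)
qed simp

lemma mpoly_induct [case_names const var add mult]:
  fixes p :: "'k::comm_ring_1 mpoly"
  assumes const: "\<And>c. P (mpmonom 0 c)" and var: "\<And>i. P (var i)"
    and add: "\<And>p q. P p \<Longrightarrow> P q \<Longrightarrow> P (p + q)" and mult: "\<And>p q. P p \<Longrightarrow> P q \<Longrightarrow> P (p * q)"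
  shows "P p"
proof -
  have zero: "P 0" and one: "P 1" using const[of 0] const[of 1] by simp_all
  have power: "P (var i ^ b)" for i b
    by (induction b) (simp_all add: one var mult)
  have "P (mpmonom \<alpha> c)" for \<alpha> c
  proof (induction \<alpha> rule: update_induct)
    case (update \<alpha> i b)
    have "Poly_Mapping.update i b \<alpha> = \<alpha> + Poly_Mapping.single i b"
      using update(1)
      by (intro poly_mapping_eqI)
        (auto simp: lookup_update lookup_add lookup_single when_def in_keys_iff)
    then have "mpmonom (Poly_Mapping.update i b \<alpha>) c = mpmonom \<alpha> c * var i ^ b"
      by (simp add: mult_single flip: mpmonom_power_var)
    then show ?case using update(3) power mult by simp
  qed (rule const)
  then have "P (\<Sum>\<alpha>\<in>S. mpmonom \<alpha> (lookup p \<alpha>))" for S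
    by (induction S rule: infinite_finite_induct) (simp_all add: zero add)
  then show ?thesis using poly_eq_sum_mono[of p] by metis
qed

text \<open>
  A commutator of derivations is again a derivation, hence determined by its values on the variables.
  All relations between \<open>weitz\<close>, \<open>weitz_hat\<close> and the partial derivatives are read off from this.
\<close>

lemma derivation_of_commutator:
  fixes p :: "'k::comm_ring_1 mpoly"
  shows "derivation_of g (derivation_of h p) - derivation_of h (derivation_of g p) =
    derivation_of (\<lambda>i. derivation_of g (h i) - derivation_of h (g i)) p"
proof (induction p rule: mpoly_induct)
  case (add p q)
  then show ?case by (simp add: derivation_of_add algebra_simps)
next
  case (mult p q)
  let ?k = "\<lambda>i. derivation_of g (h i) - derivation_of h (g i)"
  have "derivation_of g (derivation_of h (p * q)) - derivation_of h (derivation_of g (p * q)) =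
    (derivation_of g (derivation_of h p) - derivation_of h (derivation_of g p)) * q +
    p * (derivation_of g (derivation_of h q) - derivation_of h (derivation_of g q))"
    by (simp add: derivation_of_add derivation_of_mult algebra_simps)
  then show ?case unfolding mult by (simp add: derivation_of_mult)
qed (simp_all add: derivation_of_const derivation_of_var)

text \<open>
  Monomials are eigenvectors of a derivation that scales every variable. With \<open>c i = 1\<close> this is
  Euler's identity; with \<open>c i = n - 2i\<close> it identifies the Cartan element of \<open>sl\<^sub>2\<close> with the weight.
\<close>

lemma derivation_of_diagonal:
  fixes p :: "'k::comm_ring_1 mpoly"
  assumes "\<And>\<alpha>. \<alpha> \<in> keys p \<Longrightarrow> (\<Sum>i\<in>keys \<alpha>. c i * of_nat (lookup \<alpha> i)) = s"
  shows "derivation_of (\<lambda>i. smult (c i) (var i)) p = smult s p"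
proof -
  let ?e = "\<lambda>i. Poly_Mapping.single i (1::nat)"
  have summand: "mpmonom (\<alpha> - ?e i) (of_nat (lookup \<alpha> i) * lookup p \<alpha>) * smult (c i) (var i) =
      mpmonom \<alpha> (c i * of_nat (lookup \<alpha> i) * lookup p \<alpha>)" if "i \<in> keys \<alpha>" for \<alpha> i
  proof -
    have "lookup \<alpha> i \<noteq> 0" using that by (simp add: in_keys_iff)
    then have "\<alpha> - ?e i + ?e i = \<alpha>"
      using exponent_diff_add[of \<alpha> i "?e i"] by simp
    then show ?thesis by (simp add: smult_def var_def mult_single ac_simps)
  qed
  have mpmonom_sum: "(\<Sum>i\<in>I. mpmonom \<alpha> (a i)) = mpmonom \<alpha> (sum a I)" for I \<alpha> and a :: "nat \<Rightarrow> 'k"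
    by (induction I rule: infinite_finite_induct) (simp_all add: single_add)
  have "derivation_of (\<lambda>i. smult (c i) (var i)) p =
      (\<Sum>\<alpha>\<in>keys p. \<Sum>i\<in>keys \<alpha>. mpmonom \<alpha> (c i * of_nat (lookup \<alpha> i) * lookup p \<alpha>))"
    unfolding derivation_of_def by (intro sum.cong refl summand)
  also have "\<dots> = (\<Sum>\<alpha>\<in>keys p. mpmonom \<alpha> (s * lookup p \<alpha>))"
    by (intro sum.cong refl) (simp add: mpmonom_sum assms sum_distrib_right[symmetric])
  also have "\<dots> = smult s (\<Sum>\<alpha>\<in>keys p. mpmonom \<alpha> (lookup p \<alpha>))"
    by (simp add: smult_def sum_distrib_left mult_single)
  finally show ?thesis by (simp only: poly_eq_sum_mono)
qed

section \<open>The two Weitzenboeck derivations generate sl2\<close>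

lemma weitz_bihom: "p \<in> bihom n m w \<Longrightarrow> weitz n p \<in> bihom n m (w + 2)"
  for p :: "'k::comm_ring_1 mpoly"
proof -
  assume p: "p \<in> bihom n m w"
  have "derivation_of (\<lambda>i. if 1 \<le> i \<and> i \<le> n then var (i - 1) else 0) p \<in> bihom n (m + 1 - 1) (w + 2)"
  proof (rule derivation_of_bihom[OF p])
    fix i assume "i \<le> n"
    then show "(if 1 \<le> i \<and> i \<le> n then var (i - 1) else 0) \<in> bihom n 1 (2 + (int n - 2 * int i))"
      using bihom_var[of "i - 1" n] by (cases i) (auto simp: bihom_zero algebra_simps)
  qed
  then show ?thesis by (simp add: weitz_def)
qed

lemma weitz_hat_bihom: "p \<in> bihom n m w \<Longrightarrow> weitz_hat n p \<in> bihom n m (w - 2)"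
  for p :: "'k::comm_ring_1 mpoly"
proof -
  assume p: "p \<in> bihom n m w"
  have "derivation_of (\<lambda>i. if i < n then smult (of_nat ((i + 1) * (n - i))) (var (i + 1)) else 0) p
    \<in> bihom n (m + 1 - 1) (w + - 2)"
  proof (rule derivation_of_bihom[OF p])
    fix i assume "i \<le> n"
    then show "(if i < n then smult (of_nat ((i + 1) * (n - i))) (var (i + 1)) else 0)
        \<in> bihom n 1 (- 2 + (int n - 2 * int i))"
      using bihom_smult[OF bihom_var[of "i + 1" n]] bihom_zero by (auto simp: algebra_simps)
  qed
  then show ?thesis by (simp add: weitz_hat_def)
qed

text \<open>
  On \<open>x\<^sub>i\<close> the commutator is multiplication by \<open>(i+1)(n-i) - i(n+1-i) = n - 2i\<close>, the weight of \<open>x\<^sub>i\<close>.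
\<close>

lemma weitz_commutator:
  fixes p :: "'k::field_char_0 mpoly"
  assumes p: "p \<in> bihom n m w"
  shows "weitz n (weitz_hat n p) = weitz_hat n (weitz n p) + smult (of_int w) p"
proof -
  let ?g = "\<lambda>i. if 1 \<le> i \<and> i \<le> n then var (i - 1) else (0 :: 'k mpoly)"
  let ?h = "\<lambda>i. if i < n then smult (of_nat ((i + 1) * (n - i))) (var (i + 1)) else (0 :: 'k mpoly)"
  have "weitz n (weitz_hat n p) - weitz_hat n (weitz n p) =
      derivation_of (\<lambda>i. weitz n (?h i) - weitz_hat n (?g i)) p"
    unfolding weitz_def weitz_hat_def by (rule derivation_of_commutator)
  also have "\<dots> = derivation_of (\<lambda>i. smult (of_int (int n - 2 * int i)) (var i)) p"
  proof (rule derivation_of_cong)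
    show "p \<in> polys n" using p by (simp add: bihom_def)
    fix i assume i: "i \<le> n"
    have 1: "weitz n (?h i) = smult (of_nat ((i + 1) * (n - i))) (var i)"
      using i by (simp add: weitz_def derivation_of_smult derivation_of_var)
    have 2: "weitz_hat n (?g i) = smult (of_nat (i * (n + 1 - i))) (var i)"
    proof (cases i)
      case (Suc j)
      then show ?thesis using i by (simp add: weitz_hat_var mult.commute)
    qed (simp add: weitz_hat_def smult_def)
    have "int ((i + 1) * (n - i)) - int (i * (n + 1 - i)) = int n - 2 * int i"
      using i by (auto simp: le_iff_add algebra_simps)
    then have "of_nat ((i + 1) * (n - i)) - of_nat (i * (n + 1 - i)) = (of_int (int n - 2 * int i) :: 'k)"
      by (metis of_int_diff of_int_of_nat_eq)
    then show "weitz n (?h i) - weitz_hat n (?g i) = smult (of_int (int n - 2 * int i)) (var i)"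
      unfolding 1 2 by (simp only: smult.scale_left_diff_distrib[symmetric])
  qed
  also have "\<dots> = smult (of_int w) p"
  proof (rule derivation_of_diagonal)
    fix \<alpha> assume "\<alpha> \<in> keys p"
    then have "w = (\<Sum>i\<in>keys \<alpha>. (int n - 2 * int i) * int (lookup \<alpha> i))"
      using p mono_weight_superset[of "keys \<alpha>" \<alpha> n] by (auto simp: bihom_def)
    then show "(\<Sum>i\<in>keys \<alpha>. of_int (int n - 2 * int i) * of_nat (lookup \<alpha> i)) = (of_int w :: 'k)"
      by (simp del: of_int_diff)
  qed
  finally show ?thesis by (simp add: diff_eq_eq add.commute)
qed

interpretation weitz: sl2_action smult "weitz n" "weitz_hat n"
  "\<lambda>w. \<Union>m. (bihom n m w :: 'k::field_char_0 mpoly set)" for n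
proof
  fix u v :: "'k mpoly" and c :: 'k and w :: int
  show "weitz n (u + v) = weitz n u + weitz n v" "weitz n (smult c u) = smult c (weitz n u)"
    by (simp_all add: weitz_def derivation_of_add derivation_of_smult)
  show "weitz_hat n (u + v) = weitz_hat n u + weitz_hat n v"
    "weitz_hat n (smult c u) = smult c (weitz_hat n u)"
    by (simp_all add: weitz_hat_def derivation_of_add derivation_of_smult)
qed (auto intro: weitz_bihom weitz_hat_bihom weitz_commutator)

lemma weitz_hat_funpow_bihom:
  "p \<in> bihom n m w \<Longrightarrow> (weitz_hat n ^^ j) p \<in> bihom n m (w - 2 * int j)"
  for p :: "'k::comm_ring_1 mpoly"
proof (induction j)
  case (Suc j)
  then show ?case using weitz_hat_bihom[of "(weitz_hat n ^^ j) p" n m "w - 2 * int j"]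
    by (simp add: algebra_simps)
qed simp

text \<open>
  Each application lowers the weight by 2 at constant degree, and the weights in degree \<open>m\<close> are
  bounded below by \<open>-nm\<close>.
\<close>

lemma weitz_hat_nilpotent:
  fixes p :: "'k::comm_ring_1 mpoly"
  assumes "p \<in> bihom n m w"
  obtains N where "(weitz_hat n ^^ N) p = 0"
proof
  let ?N = "nat (w + int n * int m + 1)"
  let ?q = "(weitz_hat n ^^ ?N) p"
  have q: "?q \<in> bihom n m (w - 2 * int ?N)" by (rule weitz_hat_funpow_bihom[OF assms])
  show "?q = 0"
  proof (rule ccontr)
    assume "?q \<noteq> 0"
    then obtain \<alpha> where "\<alpha> \<in> keys ?q" by (meson all_not_in_conv keys_eq_empty)
    then have "- (int n * int m) \<le> w - 2 * int ?N"
      using q mono_weight_ge[of \<alpha> n] by (auto simp: bihom_def polys_def)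
    moreover have "- (int n * int m) \<le> w"
    proof -
      have "p \<noteq> 0" using \<open>?q \<noteq> 0\<close> by (auto simp: weitz_hat_funpow_zero)
      then obtain \<beta> where "\<beta> \<in> keys p" by (meson all_not_in_conv keys_eq_empty)
      then show ?thesis using assms mono_weight_ge[of \<beta> n] by (auto simp: bihom_def polys_def)
    qed
    ultimately show False by linarith
  qed
qed

lemma bihom_imp_homogeneous: "p \<in> bihom n m w \<Longrightarrow> homogeneous p"
  by (auto simp: bihom_def homogeneous_def)

lemma bihom_imp_isobaric: "p \<in> bihom n m w \<Longrightarrow> isobaric n p"
  by (auto simp: bihom_def isobaric_def)

lemma weight_bihom:
  assumes "p \<in> bihom n m w" "p \<noteq> 0"
  shows "weight n p = w"
proof -
  obtain \<alpha> where "\<alpha> \<in> keys p" using assms(2) by (meson all_not_in_conv keys_eq_empty)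
  then show ?thesis
    using weight_eq[OF bihom_imp_isobaric[OF assms(1)]] assms(1) by (auto simp: bihom_def)
qed

lemma hat_ord_eq:
  assumes "(weitz_hat n ^^ s) p \<noteq> 0" "(weitz_hat n ^^ Suc s) p = 0"
  shows "hat_ord n p = s"
  unfolding hat_ord_def
proof (rule the_equality)
  fix t assume t: "(weitz_hat n ^^ t) p \<noteq> 0 \<and> (weitz_hat n ^^ Suc t) p = 0"
  have vanish: "(weitz_hat n ^^ b) p = 0" if "(weitz_hat n ^^ Suc a) p = 0" "a < b" for a b
  proof -
    have "b = (b - Suc a) + Suc a" using that(2) by simp
    then have "(weitz_hat n ^^ b) p = (weitz_hat n ^^ (b - Suc a)) ((weitz_hat n ^^ Suc a) p)"
      by (metis funpow_add o_apply)
    then show ?thesis by (simp only: that(1) weitz_hat_funpow_zero)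
  qed
  show "t = s" using vanish[of s t] vanish[of t s] t assms by (metis linorder_neqE_nat)
qed (use assms in simp)

lemma hat_ord_highest_weight:
  fixes z :: "'k::field_char_0 mpoly"
  assumes "z \<in> bihom n m s" "z \<noteq> 0" "weitz n z = 0"
  shows "0 \<le> s" "hat_ord n z = nat s"
proof -
  obtain N where N: "(weitz_hat n ^^ N) z = 0" using weitz_hat_nilpotent[OF assms(1)] .
  have W: "z \<in> (\<Union>m. bihom n m s)" using assms(1) by blast
  note string = weitz.highest_weight_string[OF W assms(2,3) N]
  show "0 \<le> s" "hat_ord n z = nat s"
    using string(1) hat_ord_eq[OF string(2,3)] by blast+
qed

section \<open>The maps tau\<close>

lemma tau_v_0:
  fixes z :: "'k::field_char_0 mpoly"
  shows "tau_v n 0 z = z"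
proof -
  have "smult 1 z = z" by (rule smult.scale_one)
  then show ?thesis by (simp add: tau_v_def)
qed

lemma tau_v_bihom: "z \<in> bihom n m s \<Longrightarrow> tau_v n j z \<in> bihom n m (s - 2 * int j)"
  unfolding tau_v_def by (intro bihom_smult weitz_hat_funpow_bihom)

text \<open>
  The factorials in \<open>tau_v\<close> are chosen to absorb the factor \<open>(j+1)(s-j)\<close> of \<open>e_f_pow\<close>.
\<close>

lemma weitz_tau_v_Suc:
  fixes z :: "'k::field_char_0 mpoly"
  assumes z: "z \<in> bihom n m s" "z \<noteq> 0" "weitz n z = 0" and j: "int (Suc j) \<le> s"
  shows "weitz n (tau_v n (Suc j) z) = tau_v n j z"
proof -
  define a where "a = nat s - Suc j"
  have a: "nat (s - int (Suc j)) = a" "nat (s - int j) = Suc a" "s - int j = int (Suc a)"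
    using j by (auto simp: a_def)
  have W: "z \<in> (\<Union>m. bihom n m s)" using z(1) by blast
  have fact: "fact a / (fact (Suc j) * fact (nat s)) * of_int ((int j + 1) * (s - int j)) =
      (fact (Suc a) / (fact j * fact (nat s)) :: 'k)"
  proof -
    have "of_int ((int j + 1) * (s - int j)) = (of_nat (Suc j) * of_nat (Suc a) :: 'k)"
      unfolding a(3) by simp
    moreover have "(of_nat (Suc j) :: 'k) \<noteq> 0" by (rule of_nat_neq_0)
    ultimately show ?thesis by (simp add: field_simps del: of_nat_Suc)
  qed
  have "weitz n ((weitz_hat n ^^ Suc j) z) =
      smult (of_int ((int j + 1) * (s - int j))) ((weitz_hat n ^^ j) z)"
    using weitz.e_f_pow[OF W, of j] unfolding z(3) weitz.f_pow_zero by simp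
  then show ?thesis
    unfolding tau_v_def weight_bihom[OF z(1,2)] a(1,2) weitz.e_scale by (simp only: smult.scale_scale fact)
qed

text \<open>The coefficients of \<open>x\<^sub>i\<close> in the lift of \<open>\<tau>\<^sub>r(z)\<close> to \<open>V \<otimes> k[X]\<close>.\<close>

definition tau_coeff :: "nat \<Rightarrow> nat \<Rightarrow> 'k::field_char_0 mpoly \<Rightarrow> nat \<Rightarrow> 'k mpoly"
  where "tau_coeff n r z i = (if i \<le> r then (-1) ^ (r - i) * tau_v n (r - i) z else 0)"

lemma tau_eq_sum_tau_coeff:
  assumes "r \<le> n"
  shows "tau n r z = (\<Sum>i\<le>n. var i * tau_coeff n r z i)"
proof -
  have "tau n r z = (\<Sum>i\<le>r. var i * tau_coeff n r z i)"
    unfolding tau_def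
    by (rule sum.reindex_bij_witness[of _ "\<lambda>i. r - i" "\<lambda>i. r - i"])
      (auto simp: tau_coeff_def ac_simps)
  also have "\<dots> = (\<Sum>i\<le>n. var i * tau_coeff n r z i)"
    by (rule sum.mono_neutral_left) (use assms in \<open>auto simp: tau_coeff_def\<close>)
  finally show ?thesis .
qed

lemma tau_coeff_bihom:
  assumes "z \<in> bihom n m (w + 2 * int r)"
  shows "tau_coeff n r z i \<in> bihom n m (w + 2 * int i)"
  using bihom_neg_power[OF tau_v_bihom[OF assms, of "r - i"], of "r - i"]
  by (auto simp: tau_coeff_def bihom_zero of_nat_diff algebra_simps)

lemma weitz_tau_coeff:
  assumes z: "z \<in> bihom n m s" "z \<noteq> 0" "weitz n z = 0" and r: "int r \<le> s"
  shows "weitz n (tau_coeff n r z i) = - tau_coeff n r z (Suc i)"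
proof (cases "i < r")
  case True
  then obtain j where j: "r - i = Suc j" "r - Suc i = j" by (metis Suc_diff_Suc)
  then have "int (Suc j) \<le> s" using r by linarith
  from weitz_tau_v_Suc[OF z this] show ?thesis
    using True j by (simp add: tau_coeff_def weitz_def derivation_of_uminus derivation_of_neg_power)
next
  case False
  then show ?thesis
    using z(3) by (cases "i = r") (simp_all add: tau_coeff_def tau_v_0 weitz.e_zero)
qed

lemma chain_eq_pow:
  fixes c :: "nat \<Rightarrow> 'k::comm_ring_1 mpoly"
  assumes "\<And>i. weitz n (c i) = - c (Suc i)"
  shows "(weitz n ^^ i) (c 0) = (-1) ^ i * c i"
proof (induction i)
  case (Suc i)
  have "weitz n ((-1) ^ i * c i) = (-1) ^ i * weitz n (c i)"
    unfolding weitz_def by (rule derivation_of_neg_power)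
  then show ?case using Suc assms[of i] by simp
qed simp

text \<open>
  Induction on a bound \<open>r\<close> for the length of the chain. With \<open>z = c\<^sub>r\<close> the last term, subtracting the
  chain \<open>tau_coeff n r z\<close>, whose last term is also \<open>z\<close>, changes the sum by \<open>\<tau>\<^sub>r(z)\<close> and leaves a
  shorter chain.
\<close>

lemma sum_chain_mem:
  fixes T :: "'k::field_char_0 mpoly set"
  assumes T: "subalgebra T"
    and tau: "\<And>z i. z \<in> T \<Longrightarrow> z \<in> tau_base n i \<Longrightarrow> i \<le> n \<Longrightarrow> tau n i z \<in> T"
    and kernel: "\<And>s. {z \<in> bihom n m s. weitz n z = 0} \<subseteq> T"
    and c: "\<And>i. c i \<in> bihom n m (w + 2 * int i)" "\<And>i. weitz n (c i) = - c (Suc i)"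
      "\<And>i. r \<le> i \<Longrightarrow> c i = 0"
    and r: "r \<le> Suc n"
  shows "(\<Sum>i\<le>n. var i * c i) \<in> T"
  using c r
proof (induction r arbitrary: c)
  case 0
  have "smult 0 1 \<in> T" using T unfolding subalgebra_def by blast
  then show ?case using 0 by (simp add: smult_def)
next
  case (Suc r)
  define z where "z = c r"
  define s where "s = w + 2 * int r"
  show ?case
  proof (cases "z = 0")
    case True
    have "c i = 0" if "r \<le> i" for i
      using that Suc.prems(3)[of i] True by (cases "i = r") (auto simp: z_def)
    then show ?thesis using Suc.IH[OF Suc.prems(1,2)] Suc.prems(4) by simp
  next
    case False
    have z: "z \<in> bihom n m s" "z \<noteq> 0" "weitz n z = 0"
      using Suc.prems(1)[of r] Suc.prems(2)[of r] Suc.prems(3)[of "Suc r"] False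
      by (simp_all add: z_def s_def)
    have "z \<in> T" using kernel z by blast
    obtain N where N: "(weitz_hat n ^^ N) (c 0) = 0"
      using weitz_hat_nilpotent[OF Suc.prems(1)[of 0]] .
    have pow: "(weitz n ^^ r) (c 0) = (-1) ^ r * z"
      unfolding z_def by (rule chain_eq_pow[of n c, OF Suc.prems(2)])
    (* This puts r within the order of z, so that tau n r z is defined. *)
    have "int r \<le> s"
    proof (rule weitz.le_weight_if_e_pow_highest[OF _ N])
      show "c 0 \<in> (\<Union>m. bihom n m (s - 2 * int r))"
        using Suc.prems(1)[of 0] by (auto simp: s_def)
      have "weitz n ((-1) ^ r * z) = (-1) ^ r * weitz n z"
        unfolding weitz_def by (rule derivation_of_neg_power)
      then show "weitz n ((weitz n ^^ r) (c 0)) = 0" unfolding pow z(3) by simp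
      show "(weitz n ^^ r) (c 0) \<noteq> 0" unfolding pow using z(2) by (cases "even r") simp_all
    qed
    have "r \<le> n" using Suc.prems(4) by simp
    have "z \<in> tau_base n r"
      unfolding tau_base_def weitz_kernel_def
      using z hat_ord_highest_weight[OF z] \<open>int r \<le> s\<close> \<open>r \<le> n\<close>
        bihom_imp_homogeneous[OF z(1)] bihom_imp_isobaric[OF z(1)]
      by (simp add: le_nat_iff) (simp add: bihom_def)
    then have "tau n r z \<in> T" using tau \<open>z \<in> T\<close> \<open>r \<le> n\<close> by blast
    define c' where "c' i = c i - tau_coeff n r z i" for i
    have "(\<Sum>i\<le>n. var i * c' i) \<in> T"
    proof (rule Suc.IH)
      show "c' i \<in> bihom n m (w + 2 * int i)" for i
        unfolding c'_def using z(1) by (intro bihom_diff Suc.prems(1) tau_coeff_bihom) (simp add: s_def)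
      show "weitz n (c' i) = - c' (Suc i)" for i
        using Suc.prems(2)[of i] weitz_tau_coeff[OF z \<open>int r \<le> s\<close>, of i]
        by (simp add: c'_def weitz_def derivation_of_diff)
      show "c' i = 0" if "r \<le> i" for i
        using that Suc.prems(3)[of i]
        by (cases "i = r") (simp_all add: c'_def tau_coeff_def tau_v_0 z_def)
    qed (use \<open>r \<le> n\<close> in simp)
    moreover have "(\<Sum>i\<le>n. var i * c i) = (\<Sum>i\<le>n. var i * c' i) + tau n r z"
      by (simp add: c'_def tau_eq_sum_tau_coeff[OF \<open>r \<le> n\<close>] right_diff_distrib sum_subtractf)
    ultimately show ?thesis using T \<open>tau n r z \<in> T\<close> by (simp add: subalgebra_def)
  qed
qed

section \<open>Partial derivatives of kernel elements\<close>

definition partial :: "nat \<Rightarrow> 'k::comm_ring_1 mpoly \<Rightarrow> 'k mpoly"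
  where "partial i = derivation_of (\<lambda>j. if j = i then 1 else 0)"

lemma euler_identity:
  fixes p :: "'k::comm_ring_1 mpoly"
  assumes p: "p \<in> bihom n m w"
  shows "(\<Sum>i\<le>n. var i * partial i p) = smult (of_nat m) p"
proof -
  have "(\<Sum>i\<le>n. var i * partial i p) =
      derivation_of (\<lambda>j. \<Sum>i\<le>n. var i * (if j = i then 1 else 0)) p"
    unfolding partial_def derivation_of_combination ..
  also have "\<dots> = derivation_of (\<lambda>j. smult 1 (var j)) p"
    by (rule derivation_of_cong[of _ n])
      (use p in \<open>auto simp: bihom_def smult_def if_distrib cong: if_cong\<close>)
  also have "\<dots> = smult (of_nat m) p"
    by (rule derivation_of_diagonal)
      (use p in \<open>auto simp: bihom_def mono_degree_def simp flip: of_nat_sum\<close>)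
  finally show ?thesis .
qed

lemma partial_bihom:
  fixes p :: "'k::comm_ring_1 mpoly"
  assumes "p \<in> bihom n m w"
  shows "partial i p \<in> bihom n (m - 1) (w - int n + 2 * int i)"
proof -
  have "derivation_of (\<lambda>j. if j = i then 1 else 0) p
    \<in> bihom n (m + 0 - 1) (w + - (int n - 2 * int i))"
    by (rule derivation_of_bihom[OF assms]) (use bihom_const[of "1::'k" n] in \<open>auto simp: bihom_zero\<close>)
  then show ?thesis by (simp add: partial_def algebra_simps)
qed

lemma partial_eq_0:
  assumes "p \<in> polys n" "n < i"
  shows "partial i p = 0"
proof -
  have "partial i p = derivation_of (\<lambda>_. 0) p"
    unfolding partial_def by (rule derivation_of_cong[OF assms(1)]) (use assms(2) in auto)
  then show ?thesis by (simp add: derivation_of_def)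
qed

text \<open>
  On variables, \<open>[d, \<partial>/\<partial>x\<^sub>i]\<close> is nonzero only at \<open>x\<^bsub>i+1\<^esub>\<close>, where \<open>d\<close> has produced \<open>x\<^sub>i\<close>, so it equals
  \<open>-\<partial>/\<partial>x\<^bsub>i+1\<^esub>\<close>.
\<close>

lemma weitz_partial:
  fixes p :: "'k::comm_ring_1 mpoly"
  assumes p: "p \<in> polys n" "weitz n p = 0"
  shows "weitz n (partial i p) = - partial (Suc i) p"
proof -
  let ?g = "\<lambda>j. if 1 \<le> j \<and> j \<le> n then var (j - 1) else (0 :: 'k mpoly)"
  let ?\<delta> = "\<lambda>i j. if j = i then 1 else (0 :: 'k mpoly)"
  have one: "derivation_of g 1 = 0" for g :: "nat \<Rightarrow> 'k mpoly"
    using derivation_of_const[of g 1] by simp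
  have "weitz n (partial i p) - partial i (weitz n p) =
      derivation_of (\<lambda>j. derivation_of ?g (?\<delta> i j) - derivation_of (?\<delta> i) (?g j)) p"
    unfolding weitz_def partial_def by (rule derivation_of_commutator)
  also have "\<dots> = derivation_of (\<lambda>j. \<Sum>l\<in>{Suc i}. -1 * ?\<delta> l j) p"
  proof (rule derivation_of_cong[OF p(1)])
    fix j assume "j \<le> n"
    then show "derivation_of ?g (?\<delta> i j) - derivation_of (?\<delta> i) (?g j) = (\<Sum>l\<in>{Suc i}. -1 * ?\<delta> l j)"
      by (cases j) (simp_all add: one derivation_of_var)
  qed
  also have "\<dots> = - partial (Suc i) p"
    unfolding derivation_of_combination partial_def by simp
  finally show ?thesis by (simp add: p(2) partial_def)
qed

section \<open>Generation of the kernel\<close>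

text \<open>
  Induction on the degree. Euler's identity writes \<open>p\<close> as a multiple of \<open>\<Sum>\<^sub>i x\<^sub>i \<partial>p/\<partial>x\<^sub>i\<close>, and the partial
  derivatives form a chain in degree one less, whose kernel elements are in \<open>T\<close> by induction.
\<close>

lemma bihom_kernel_subset:
  fixes T :: "'k::field_char_0 mpoly set"
  assumes T: "subalgebra T"
    and tau: "\<And>z i. z \<in> T \<Longrightarrow> z \<in> tau_base n i \<Longrightarrow> i \<le> n \<Longrightarrow> tau n i z \<in> T"
  shows "{p \<in> bihom n m w. weitz n p = 0} \<subseteq> T"
proof (induction m arbitrary: w)
  case 0
  show ?case
  proof
    fix p :: "'k mpoly" assume "p \<in> {p \<in> bihom n 0 w. weitz n p = 0}"
    then have "keys p \<subseteq> {0}"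
      by (auto simp: bihom_def mono_degree_def in_keys_iff intro!: poly_mapping_eqI)
    then have "p = smult (lookup p 0) 1"
      by (intro poly_mapping_eqI)
        (auto simp: lookup_smult lookup_one when_def in_keys_iff)
    then show "p \<in> T" using T unfolding subalgebra_def by metis
  qed
next
  case (Suc m)
  show ?case
  proof
    fix p :: "'k mpoly" assume "p \<in> {p \<in> bihom n (Suc m) w. weitz n p = 0}"
    then have p: "p \<in> bihom n (Suc m) w" "weitz n p = 0" "p \<in> polys n"
      by (auto simp: bihom_def)
    have "(\<Sum>i\<le>n. var i * partial i p) \<in> T"
    proof (rule sum_chain_mem[OF T tau Suc.IH])
      show "partial i p \<in> bihom n m (w - int n + 2 * int i)" for i
        using partial_bihom[OF p(1), of i] by simp
      show "weitz n (partial i p) = - partial (Suc i) p" for i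
        by (rule weitz_partial[OF p(3,2)])
      show "partial i p = 0" if "Suc n \<le> i" for i
        using partial_eq_0[OF p(3)] that by simp
    qed simp_all
    then have "smult (inverse (of_nat (Suc m))) (smult (of_nat (Suc m)) p) \<in> T"
      using T unfolding euler_identity[OF p(1)] subalgebra_def by blast
    then show "p \<in> T"
      by (simp only: smult.scale_scale left_inverse[OF of_nat_neq_0] smult.scale_one)
  qed
qed

text \<open>
  \<open>weitz n\<close> keeps the degree and adds 2 to the weight, so the images of distinct components have
  disjoint sets of monomials and cannot cancel.
\<close>

lemma weitz_kernel_bihom_decomposition:
  fixes p :: "'k::comm_ring_1 mpoly"
  assumes "p \<in> weitz_kernel n"
  obtains I :: "(nat \<times> int) set" and q where "p = (\<Sum>i\<in>I. q i)" "finite I"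
    "\<And>m w. q (m, w) \<in> bihom n m w" "\<And>m w. (m, w) \<in> I \<Longrightarrow> weitz n (q (m, w)) = 0"
proof -
  have p: "p \<in> polys n" "weitz n p = 0" using assms by (auto simp: weitz_kernel_def)
  define \<delta> where "\<delta> \<alpha> = (mono_degree \<alpha>, mono_weight n \<alpha>)" for \<alpha>
  define I where "I = \<delta> ` keys p"
  define q where "q i = (\<Sum>\<alpha> | \<alpha> \<in> keys p \<and> \<delta> \<alpha> = i. mpmonom \<alpha> (lookup p \<alpha>))" for i
  have "finite I" by (simp add: I_def)
  have sum: "p = (\<Sum>i\<in>I. q i)"
    unfolding q_def I_def
    using sum.image_gen[of "keys p" "\<lambda>\<alpha>. mpmonom \<alpha> (lookup p \<alpha>)" \<delta>]
    by (simp add: poly_eq_sum_mono)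
  have q: "q (m, w) \<in> bihom n m w" for m w
    unfolding q_def
  proof (intro bihom_sum)
    fix \<alpha> assume "\<alpha> \<in> {\<alpha> \<in> keys p. \<delta> \<alpha> = (m, w)}"
    then show "mpmonom \<alpha> (lookup p \<alpha>) \<in> bihom n m w"
      using bihom_mpmonom[of \<alpha> n "lookup p \<alpha>"] p(1) by (auto simp: \<delta>_def polys_def)
  qed
  have "weitz n (q (m, w)) = 0" if "(m, w) \<in> I" for m w
  proof (rule ccontr)
    assume "weitz n (q (m, w)) \<noteq> 0"
    then obtain \<beta> where \<beta>: "\<beta> \<in> keys (weitz n (q (m, w)))"
      by (meson all_not_in_conv keys_eq_empty)
    have degrees: "\<delta> \<gamma> = (m', w' + 2)" if "\<gamma> \<in> keys (weitz n (q (m', w')))" for \<gamma> m' w'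
      using weitz_bihom[OF q[of m' w']] that by (simp add: bihom_def \<delta>_def)
    have "lookup (weitz n (q i)) \<beta> = 0" if "i \<in> I - {(m, w)}" for i
      using degrees[OF \<beta>] degrees[of \<beta> "fst i" "snd i"] that by (cases i) (auto simp: in_keys_iff)
    then have "(\<Sum>i\<in>I. lookup (weitz n (q i)) \<beta>) = lookup (weitz n (q (m, w))) \<beta>"
      using \<open>finite I\<close> \<open>(m, w) \<in> I\<close> by (simp add: sum.remove)
    moreover have "weitz n p = (\<Sum>i\<in>I. weitz n (q i))"
      unfolding sum weitz_def by (rule derivation_of_sum)
    ultimately show False using p(2) \<beta> by (simp add: lookup_sum[symmetric] in_keys_iff)
  qed
  then show thesis using that[OF sum \<open>finite I\<close> q] by blast
qed

theorem theorem5p2: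
  fixes n :: nat and T :: "'k::field_char_0 mpoly set"
  assumes "subalgebra T"
    and "T \<subseteq> weitz_kernel n"
    and "var 0 \<in> T"
    and "tau_closure n T \<subseteq> T"
  shows "T = weitz_kernel n"
proof
  have tau: "tau n i z \<in> T" if "z \<in> T" "z \<in> tau_base n i" "i \<le> n" for z i
  proof -
    have "tau n i z \<in> tau_closure n T"
      unfolding tau_closure_def by (rule hull_inc) (use that tau_ext_base in blast)
    then show ?thesis using assms(4) by blast
  qed
  show "weitz_kernel n \<subseteq> T"
  proof
    fix p :: "'k mpoly" assume "p \<in> weitz_kernel n"
    then obtain I and q :: "nat \<times> int \<Rightarrow> 'k mpoly" where p: "p = (\<Sum>i\<in>I. q i)" "finite I"
      and q: "\<And>m w. q (m, w) \<in> bihom n m w" "\<And>m w. (m, w) \<in> I \<Longrightarrow> weitz n (q (m, w)) = 0"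
      by (rule weitz_kernel_bihom_decomposition) blast
    have zero: "0 \<in> T"
    proof -
      have "smult 0 1 \<in> T" using assms(1) unfolding subalgebra_def by blast
      then show ?thesis by (simp add: smult_def)
    qed
    have "q i \<in> T" if "i \<in> I" for i
      using bihom_kernel_subset[OF assms(1) tau] q that by (cases i) blast
    with \<open>finite I\<close> have "(\<Sum>i\<in>I. q i) \<in> T"
      by (induction I rule: finite_induct)
        (use assms(1) zero in \<open>auto simp: subalgebra_def\<close>)
    then show "p \<in> T" by (simp only: p(1))
  qed
qed (rule assms(2))

end
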